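(* Let $m_1+m_2=n$, $m_1>m_2$, and let $L\in\mathcal{S}_n$ be the Laplacian matrix of an undirected graph on $n$ vertices. Consider the semidefinite program (WZ) $$\begin{array}{rl} \min & \frac12\operatorname{tr} L(Y_{11}+Y_{22})\\ \text{s.t.} & \operatorname{tr}(Y_{ii})=m_i,\quad \operatorname{tr}(JY_{ii})=m_i^2,\quad i=1,2,\\ & \operatorname{diag}(Y_{12})=0,\quad \operatorname{tr} J(Y_{12}+Y_{12}^{\mathrm T})=2m_1m_2,\\ & Y=\begin{pmatrix}Y_{11}&Y_{12}\\ Y_{12}^{\mathrm T}&Y_{22}\end{pmatrix}\in\mathcal{S}_{2n},\quad y=\operatorname{diag}(Y),\quad Y-yy^{\mathrm T}\succeq 0,\quad Y\ge 0, \end{array}$$ and the semidefinite program (N) $$\begin{array}{rl} \min & \frac12\operatorname{tr} L(2X+J-xe^{\mathrm T}-ex^{\mathrm T})\\ \text{s.t.} & x^{\mathrm T}e=m_1,\quad \operatorname{tr}(JX)=m_1^2,\quad Xe=m_1x,\\ & X\ge0,\quad xe^{\mathrm T}-X\ge0,\quad J+X-xe^{\mathrm T}-ex^{\mathrm T}\ge0,\\ & X\succeq0,\quad \operatorname{diag}(X)=x,\quad X\in\mathcal{S}_n. \end{array}$$ Then (WZ) and (N) are equivalent.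
   Context: $m_1,m_2$ are positive integers (the prescribed sizes of the two parts of a bisection of the vertex set of a graph $G$ with $n$ vertices). $A$ is the (possibly edge-weighted) symmetric adjacency matrix of $G$, and $L=\operatorname{Diag}(Ae)-A$ is its Laplacian matrix, where $\operatorname{Diag}(v)$ is the diagonal matrix with diagonal $v$. $\mathcal{S}_k$ is the space of real symmetric $k\times k$ matrices; $e$ is the all-ones vector in $\mathbb{R}^n$; $J=ee^{\mathrm T}$ is the $n\times n$ all-ones matrix; $\operatorname{diag}(M)$ is the vector of diagonal entries of a square matrix $M$; $M\succeq0$ means positive semidefinite; $M\ge0$ means entrywise nonnegative. The blocks $Y_{11},Y_{12},Y_{22}$ are $n\times n$. Two semidefinite relaxations are called equivalent if they give the same bound, i.e. their optimal values are equal. *)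

theory Defs
  imports "HOL-Analysis.Analysis"
begin

definition all_ones_vec :: "real^'n" where
  "all_ones_vec = (\<chi> i. 1)"

definition outer :: "real^'n \<Rightarrow> real^'m \<Rightarrow> real^'m^'n" where
  "outer u v = (\<chi> i j. u $ i * v $ j)"

definition all_ones_mat :: "real^'n^'n" where
  "all_ones_mat = outer all_ones_vec all_ones_vec"

definition diag_vec :: "real^'n^'n \<Rightarrow> real^'n" where
  "diag_vec M = (\<chi> i. M $ i $ i)"

definition diag_mat :: "real^'n \<Rightarrow> real^'n^'n" where
  "diag_mat v = (\<chi> i j. if i = j then v $ i else 0)"

definition symmetric_mat :: "real^'n^'n \<Rightarrow> bool" where
  "symmetric_mat M \<longleftrightarrow> transpose M = M"

definition psd :: "real^'n^'n \<Rightarrow> bool" where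
  "psd M \<longleftrightarrow> symmetric_mat M \<and> (\<forall>x. 0 \<le> x \<bullet> (M *v x))"

text \<open>
  The order on vectors, and hence on matrices, in HOL-Analysis is componentwise, so \<open>0 \<le> M\<close>
  below means entrywise nonnegativity (not the Loewner order, for which \<^const>\<open>psd\<close> is used).
\<close>

text \<open>
  The vertex set is the whole finite type \<open>'n\<close> and an edge is a set of exactly two vertices.
  An unweighted graph is the case where the weight function is constantly \<open>1\<close>.
\<close>

definition undirected_graph :: "'n set set \<Rightarrow> bool" where
  "undirected_graph E \<longleftrightarrow> (\<forall>e\<in>E. card e = 2)"

definition adjacency_mat :: "'n set set \<Rightarrow> ('n set \<Rightarrow> real) \<Rightarrow> real^'n^'n" where
  "adjacency_mat E w = (\<chi> i j. if {i, j} \<in> E then w {i, j} else 0)"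

definition laplacian :: "real^'n^'n \<Rightarrow> real^'n^'n" where
  "laplacian A = diag_mat (A *v all_ones_vec) - A"

text \<open>
  The four blocks of a matrix whose index type is the disjoint sum of two copies of \<open>'n\<close>.
  For symmetric \<open>Y\<close> the lower left block is the transpose of \<open>block12 Y\<close>.
\<close>

definition block11 :: "real^('n::finite + 'n)^('n + 'n) \<Rightarrow> real^'n^'n" where
  "block11 Y = (\<chi> i j. Y $ Inl i $ Inl j)"

definition block12 :: "real^('n::finite + 'n)^('n + 'n) \<Rightarrow> real^'n^'n" where
  "block12 Y = (\<chi> i j. Y $ Inl i $ Inr j)"

definition block22 :: "real^('n::finite + 'n)^('n + 'n) \<Rightarrow> real^'n^'n" where
  "block22 Y = (\<chi> i j. Y $ Inr i $ Inr j)"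

definition wz_feasible :: "nat \<Rightarrow> nat \<Rightarrow> (real^('n::finite + 'n)^('n + 'n)) set" where
  "wz_feasible m1 m2 = {Y.
     symmetric_mat Y \<and>
     trace (block11 Y) = real m1 \<and>
     trace (block22 Y) = real m2 \<and>
     trace (all_ones_mat ** block11 Y) = (real m1)\<^sup>2 \<and>
     trace (all_ones_mat ** block22 Y) = (real m2)\<^sup>2 \<and>
     diag_vec (block12 Y) = 0 \<and>
     trace (all_ones_mat ** (block12 Y + transpose (block12 Y))) = 2 * real m1 * real m2 \<and>
     psd (Y - outer (diag_vec Y) (diag_vec Y)) \<and>
     0 \<le> Y}"

definition wz_objective ::
  "real^'n^'n \<Rightarrow> real^('n::finite + 'n)^('n + 'n) \<Rightarrow> real" where
  "wz_objective L Y = 1 / 2 * trace (L ** (block11 Y + block22 Y))"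

definition n_feasible :: "nat \<Rightarrow> ((real^'n^'n) \<times> (real^'n)) set" where
  "n_feasible m1 = {(X, x).
     symmetric_mat X \<and>
     x \<bullet> all_ones_vec = real m1 \<and>
     trace (all_ones_mat ** X) = (real m1)\<^sup>2 \<and>
     X *v all_ones_vec = real m1 *\<^sub>R x \<and>
     0 \<le> X \<and>
     0 \<le> outer x all_ones_vec - X \<and>
     0 \<le> all_ones_mat + X - outer x all_ones_vec - outer all_ones_vec x \<and>
     psd X \<and>
     diag_vec X = x}"

definition n_objective :: "real^'n^'n \<Rightarrow> (real^'n^'n) \<times> (real^'n) \<Rightarrow> real" where
  "n_objective L = (\<lambda>(X, x).
     1 / 2 * trace (L ** (2 *\<^sub>R X + all_ones_mat - outer x all_ones_vec - outer all_ones_vec x)))"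

text \<open>
  Optimal values live in the extended reals, so that infeasible or unbounded programs would get
  the values \<open>\<infinity>\<close> and \<open>-\<infinity>\<close>.
\<close>

definition optimal_value :: "'a set \<Rightarrow> ('a \<Rightarrow> real) \<Rightarrow> ereal" where
  "optimal_value F f = (INF z\<in>F. ereal (f z))"

definition wz_value :: "nat \<Rightarrow> nat \<Rightarrow> real^'n^'n \<Rightarrow> ereal" where
  "wz_value m1 m2 L = optimal_value (wz_feasible m1 m2) (wz_objective L)"

definition n_value :: "nat \<Rightarrow> real^'n^'n \<Rightarrow> ereal" where
  "n_value m1 L = optimal_value (n_feasible m1) (n_objective L)"

end

theory Submission
  imports Defs
begin

text \<open>
  The two programs have, up to renaming, the same feasible points: \<open>Y \<mapsto> (Y\<^sub>1\<^sub>1, diag Y\<^sub>1\<^sub>1)\<close> carries the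
  feasible set of (WZ) into that of (N), the lift \<open>wz_lift\<close> goes back, and both maps keep the
  objective value.

  The constraints of (WZ) force certain vectors into the kernel of \<open>M = Y - yy\<^sup>T\<close>. Since \<open>M\<close> is
  positive semidefinite, it suffices that the quadratic form of \<open>M\<close> vanishes at a vector
  (\<open>psd_kernel\<close>). It vanishes at \<open>(e, 0)\<close> by the two constraints on \<open>Y\<^sub>1\<^sub>1\<close>, which gives
  \<open>Y\<^sub>1\<^sub>1 e = m\<^sub>1 x\<close>. At \<open>(e\<^sub>i, e\<^sub>i)\<close> it is \<open>s\<^sub>i - s\<^sub>i\<^sup>2\<close> where \<open>s\<^sub>i\<close> is the sum of the two diagonal entries of
  \<open>Y\<close> that belong to vertex \<open>i\<close>, because \<open>diag Y\<^sub>1\<^sub>2 = 0\<close>. Hence \<open>s\<^sub>i \<le> 1\<close>, and as the \<open>s\<^sub>i\<close> sum to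
  \<open>m\<^sub>1 + m\<^sub>2 = n\<close>, every \<open>s\<^sub>i\<close> is \<open>1\<close> and every \<open>(e\<^sub>i, e\<^sub>i)\<close> lies in the kernel. This determines all of \<open>Y\<close>
  from \<open>X = Y\<^sub>1\<^sub>1\<close> and \<open>x = diag X\<close>: \<open>Y\<^sub>1\<^sub>2 = xe\<^sup>T - X\<close> and \<open>Y\<^sub>2\<^sub>2 = J + X - xe\<^sup>T - ex\<^sup>T\<close>
  (\<open>wz_feasible_blocks\<close>). Nonnegativity of these blocks is what (N) demands.

  Conversely, for \<open>Y\<close> built from \<open>(X, x)\<close> by these formulas, \<open>Y - yy\<^sup>T\<close> has the blocks
  \<open>Z, -Z, -Z, Z\<close> with \<open>Z = X - xx\<^sup>T\<close>, so its quadratic form at \<open>(u, v)\<close> is that of \<open>Z\<close> at \<open>u - v\<close>.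
  Finally \<open>Z\<close> is positive semidefinite because it is a Schur complement: \<open>Xe = m\<^sub>1 x\<close> and
  \<open>e\<^sup>T X e = m\<^sub>1\<^sup>2 > 0\<close> (\<open>psd_diff_outer\<close>).
\<close>

section \<open>Positive semidefinite matrices and rank-one corrections\<close>

lemma outer_mult_vec: "outer u v *v z = (v \<bullet> z) *\<^sub>R u"
  by (simp add: outer_def matrix_vector_mult_def vec_eq_iff inner_vec_def sum_distrib_left
      mult_ac)

lemma symmetric_mat_entry: "symmetric_mat M \<Longrightarrow> M $ i $ j = M $ j $ i"
  unfolding symmetric_mat_def by (metis transpose_def vec_lambda_beta)

lemma symmetric_mat_inner:
  fixes M :: "real^'n::finite^'n"
  assumes "symmetric_mat M"
  shows "u \<bullet> (M *v v) = (M *v u) \<bullet> v"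
  using assms by (metis symmetric_mat_def dot_lmul_matrix transpose_matrix_vector)

text \<open>
  If \<open>v \<bullet> Mv = 0\<close> then \<open>v\<close> minimises the quadratic form, so the derivative in the direction
  \<open>u = Mv\<close>, which is \<open>2 u \<bullet> u\<close>, vanishes.
\<close>

lemma psd_kernel:
  fixes M :: "real^'n::finite^'n"
  assumes "psd M" and z: "v \<bullet> (M *v v) = 0"
  shows "M *v v = 0"
proof -
  have sym: "symmetric_mat M" and pos: "\<And>x. 0 \<le> x \<bullet> (M *v x)"
    using assms(1) by (auto simp: psd_def)
  define u where "u = M *v v"
  define a where "a = u \<bullet> u"
  define c where "c = u \<bullet> (M *v u)"
  have c: "0 \<le> c"
    using pos c_def by simp
  have vu: "v \<bullet> (M *v u) = a"
    by (simp add: symmetric_mat_inner[OF sym] u_def a_def)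
  have nonneg: "0 \<le> 2 * t * a + t\<^sup>2 * c" for t :: real
  proof -
    have "0 \<le> (v + t *\<^sub>R u) \<bullet> (M *v (v + t *\<^sub>R u))"
      by (rule pos)
    also have "\<dots> = v \<bullet> (M *v v) + t * (v \<bullet> (M *v u)) + t * (u \<bullet> (M *v v)) + t\<^sup>2 * (u \<bullet> (M *v u))"
      by (simp add: matrix_vector_right_distrib scaleR_matrix_vector_assoc[symmetric]
          matrix_vector_mult_scaleR inner_left_distrib inner_right_distrib power2_eq_square
          algebra_simps)
    also have "\<dots> = 2 * t * a + t\<^sup>2 * c"
      using z vu by (simp add: u_def[symmetric] a_def[symmetric] c_def[symmetric])
    finally show ?thesis .
  qed
  \<comment> \<open>with this \<open>t\<close> the linear term dominates the quadratic one, also for \<open>c = 0\<close>\<close>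
  define t where "t = - a / (c + 1)"
  have t: "t * (c + 1) = - a"
    using c by (simp add: t_def)
  have "0 \<le> (2 * t * a + t\<^sup>2 * c) * (c + 1)\<^sup>2"
    using nonneg by simp
  also have "\<dots> = 2 * (t * (c + 1)) * (c + 1) * a + (t * (c + 1))\<^sup>2 * c"
    by (simp add: power2_eq_square algebra_simps)
  also have "\<dots> = - (a\<^sup>2 * (c + 2))"
    unfolding t by (simp add: power2_eq_square algebra_simps)
  finally have "a\<^sup>2 * (c + 2) \<le> 0"
    by simp
  then have "a = 0"
    using c by (simp add: mult_le_0_iff)
  then show ?thesis
    by (simp add: a_def u_def)
qed

lemma psd_diff_outer_kernel:
  fixes Y :: "real^'n::finite^'n"
  assumes "psd (Y - outer y y)" and "z \<bullet> (Y *v z) = (y \<bullet> z)\<^sup>2"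
  shows "Y *v z = (y \<bullet> z) *\<^sub>R y"
proof -
  have "z \<bullet> ((Y - outer y y) *v z) = 0"
    using assms(2)
    by (simp add: matrix_vector_mult_diff_rdistrib outer_mult_vec inner_diff_right
        power2_eq_square inner_commute)
  from psd_kernel[OF assms(1) this] show ?thesis
    by (simp add: matrix_vector_mult_diff_rdistrib outer_mult_vec)
qed

text \<open>
  Put \<open>w = v - ((x \<bullet> v)/m) e\<close>, the component of \<open>v\<close> that is orthogonal to \<open>e\<close> for the form \<open>X\<close>. Then
  \<open>v \<bullet> (X - xx\<^sup>T)v = w \<bullet> Xw\<close>, because \<open>Xe = mx\<close> and \<open>e \<bullet> Xe = m\<^sup>2\<close>.
\<close>

lemma psd_diff_outer:
  fixes X :: "real^'n::finite^'n"
  assumes X: "psd X" and Xe: "X *v e = m *\<^sub>R x" and xe: "x \<bullet> e = m" and m: "m \<noteq> 0"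
  shows "psd (X - outer x x)"
proof -
  have sym: "symmetric_mat X" and pos: "\<And>v. 0 \<le> v \<bullet> (X *v v)"
    using X by (auto simp: psd_def)
  have "symmetric_mat (X - outer x x)"
    using symmetric_mat_entry[OF sym]
    by (simp add: symmetric_mat_def transpose_def vec_eq_iff outer_def mult.commute)
  moreover have "0 \<le> v \<bullet> ((X - outer x x) *v v)" for v
  proof -
    define t where "t = (x \<bullet> v) / m"
    have eX: "e \<bullet> (X *v v) = m * (x \<bullet> v)"
      by (simp add: symmetric_mat_inner[OF sym] Xe)
    have "0 \<le> (v - t *\<^sub>R e) \<bullet> (X *v (v - t *\<^sub>R e))"
      by (rule pos)
    also have "\<dots> = v \<bullet> (X *v v) - t * m * (x \<bullet> v) - t * (m * (x \<bullet> v)) + t * t * m * m"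
      using xe by (simp add: matrix_vector_mult_diff_distrib matrix_vector_mult_scaleR Xe eX
          inner_diff_left inner_diff_right inner_commute algebra_simps)
    also have "\<dots> = v \<bullet> (X *v v) - (x \<bullet> v) * (x \<bullet> v)"
      using m by (simp add: t_def)
    also have "\<dots> = v \<bullet> ((X - outer x x) *v v)"
      by (simp add: matrix_vector_mult_diff_rdistrib outer_mult_vec inner_diff_right
          inner_commute)
    finally show ?thesis .
  qed
  ultimately show ?thesis
    by (simp add: psd_def)
qed

lemma trace_all_ones_mult:
  fixes A :: "real^'n::finite^'n"
  shows "trace (all_ones_mat ** A) = all_ones_vec \<bullet> (A *v all_ones_vec)"
proof -
  have "trace (all_ones_mat ** A) = (\<Sum>i\<in>UNIV. \<Sum>j\<in>UNIV. A $ j $ i)"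
    by (simp add: trace_def matrix_matrix_mult_def all_ones_mat_def outer_def all_ones_vec_def)
  also have "\<dots> = (\<Sum>j\<in>UNIV. \<Sum>i\<in>UNIV. A $ j $ i)"
    by (rule sum.swap)
  finally show ?thesis
    by (simp add: inner_vec_def matrix_vector_mult_def all_ones_vec_def)
qed

lemma trace_eq_diag_vec: "trace A = diag_vec A \<bullet> all_ones_vec"
  by (simp add: trace_def diag_vec_def inner_vec_def all_ones_vec_def)

lemma all_ones_vec_inner_self: "all_ones_vec \<bullet> (all_ones_vec :: real^'n::finite) = real CARD('n)"
  by (simp add: inner_vec_def all_ones_vec_def)

section \<open>Vectors and matrices in block form\<close>

definition stack :: "real^'n \<Rightarrow> real^'m \<Rightarrow> real^('n + 'm)" where
  "stack u v = (\<chi> k. case k of Inl i \<Rightarrow> u $ i | Inr j \<Rightarrow> v $ j)"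

lemma stack_nth [simp]: "stack u v $ Inl i = u $ i" "stack u v $ Inr j = v $ j"
  by (simp_all add: stack_def)

lemma vec_sum_eq_iff: "v = w \<longleftrightarrow> (\<forall>i. v $ Inl i = w $ Inl i) \<and> (\<forall>j. v $ Inr j = w $ Inr j)"
  by (metis vec_eq_iff sum.exhaust)

lemma stack_cases: obtains u v where "z = stack u v"
  by (rule that[of "\<chi> i. z $ Inl i" "\<chi> j. z $ Inr j"]) (simp add: vec_sum_eq_iff)

lemma sum_UNIV_Plus:
  "(\<Sum>k\<in>UNIV. f k) = (\<Sum>i\<in>UNIV. f (Inl i)) + (\<Sum>j\<in>UNIV. f (Inr j))"
  for f :: "'a::finite + 'b::finite \<Rightarrow> real"
  by (simp add: UNIV_Plus_UNIV[symmetric] sum.Plus del: UNIV_Plus_UNIV)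

lemma inner_stack: "stack a b \<bullet> stack c d = a \<bullet> c + b \<bullet> d"
  for a c :: "real^'n::finite" and b d :: "real^'m::finite"
  by (simp add: inner_vec_def sum_UNIV_Plus)

lemma stack_eq_iff: "stack a b = stack c d \<longleftrightarrow> a = c \<and> b = d"
  by (simp add: vec_sum_eq_iff vec_eq_iff)

lemma scaleR_stack: "r *\<^sub>R stack a b = stack (r *\<^sub>R a) (r *\<^sub>R b)"
  by (simp add: vec_sum_eq_iff)

lemma diag_vec_stack: "diag_vec Y = stack (diag_vec (block11 Y)) (diag_vec (block22 Y))"
  by (simp add: vec_sum_eq_iff diag_vec_def block11_def block22_def)

lemma symmetric_mat_mult_stack:
  assumes "symmetric_mat Y"
  shows "Y *v stack u v =
    stack (block11 Y *v u + block12 Y *v v) (transpose (block12 Y) *v u + block22 Y *v v)"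
  using symmetric_mat_entry[OF assms]
  by (simp add: vec_sum_eq_iff matrix_vector_mult_def sum_UNIV_Plus block11_def block12_def
      block22_def transpose_def)

lemma symmetric_block11: "symmetric_mat Y \<Longrightarrow> symmetric_mat (block11 Y)"
  by (simp add: symmetric_mat_def vec_eq_iff transpose_def block11_def)

section \<open>From (WZ) to (N)\<close>

text \<open>Adding back \<open>yy\<^sup>T\<close> keeps the form nonnegative, and vectors \<open>(u, 0)\<close> only see the first block.\<close>

lemma psd_block11_of_diff_outer:
  assumes "symmetric_mat Y" and "psd (Y - outer y y)"
  shows "psd (block11 Y)"
proof -
  have "0 \<le> u \<bullet> (block11 Y *v u)" for u
  proof -
    have "0 \<le> stack u 0 \<bullet> ((Y - outer y y) *v stack u 0)"
      using assms(2) by (simp add: psd_def)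
    also have "\<dots> = u \<bullet> (block11 Y *v u) - (y \<bullet> stack u 0)\<^sup>2"
      by (simp add: matrix_vector_mult_diff_rdistrib outer_mult_vec inner_diff_right
          symmetric_mat_mult_stack[OF assms(1)] inner_stack power2_eq_square inner_commute)
    finally show ?thesis
      by (smt (verit) zero_le_power2)
  qed
  then show ?thesis
    using symmetric_block11[OF assms(1)] by (simp add: psd_def)
qed

text \<open>
  The first equation comes from the kernel vector \<open>(e, 0)\<close>. The second is \<open>s\<^sub>i = 1\<close>, which puts
  \<open>(e\<^sub>i, e\<^sub>i)\<close> into the kernel; this gives the last two, one column for each vertex \<open>i\<close>.
\<close>

lemma wz_feasible_blocks:
  fixes Y :: "real^('n::finite + 'n)^('n + 'n)"
  assumes card: "m1 + m2 = CARD('n)" and Y: "Y \<in> wz_feasible m1 m2"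
  defines "X \<equiv> block11 Y" and "x \<equiv> diag_vec (block11 Y)"
  shows "X *v all_ones_vec = real m1 *\<^sub>R x"
    and "diag_vec (block22 Y) = all_ones_vec - x"
    and "block12 Y = outer x all_ones_vec - X"
    and "block22 Y = all_ones_mat + X - outer x all_ones_vec - outer all_ones_vec x"
proof -
  have sym: "symmetric_mat Y"
    and tr1: "trace (block11 Y) = real m1" and tr2: "trace (block22 Y) = real m2"
    and J1: "trace (all_ones_mat ** block11 Y) = (real m1)\<^sup>2"
    and d12: "diag_vec (block12 Y) = 0"
    and M: "psd (Y - outer (diag_vec Y) (diag_vec Y))"
    using Y by (auto simp: wz_feasible_def)
  define x' where "x' = diag_vec (block22 Y)"
  have y: "diag_vec Y = stack x x'"
    by (simp add: diag_vec_stack x_def x'_def)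
  have xe: "x \<bullet> all_ones_vec = real m1" and x'e: "x' \<bullet> all_ones_vec = real m2"
    using tr1 tr2 by (simp_all add: trace_eq_diag_vec x_def x'_def)
  have "Y *v stack all_ones_vec 0 = (diag_vec Y \<bullet> stack all_ones_vec 0) *\<^sub>R diag_vec Y"
    using J1 xe
    by (intro psd_diff_outer_kernel[OF M])
      (simp add: y symmetric_mat_mult_stack[OF sym] inner_stack trace_all_ones_mult)
  then show "X *v all_ones_vec = real m1 *\<^sub>R x"
    using xe by (simp add: y symmetric_mat_mult_stack[OF sym] inner_stack scaleR_stack
        stack_eq_iff X_def)

  define z :: "'n \<Rightarrow> real^('n + 'n)" where "z i = stack (axis i 1) (axis i 1)" for i
  have Yz: "Y *v z i = stack (column i (block11 Y) + column i (block12 Y))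
      (column i (transpose (block12 Y)) + column i (block22 Y))" for i
    by (simp only: z_def symmetric_mat_mult_stack[OF sym] matrix_vector_mult_basis)
  have yz: "diag_vec Y \<bullet> z i = x $ i + x' $ i" for i
    by (simp add: y z_def inner_stack inner_axis)
  have form: "z i \<bullet> (Y *v z i) = x $ i + x' $ i" for i
  proof -
    have "block12 Y $ i $ i = 0"
      using d12 by (simp add: diag_vec_def vec_eq_iff)
    then show ?thesis
      by (subst Yz) (simp add: z_def inner_stack inner_axis' column_def transpose_def x_def x'_def
          diag_vec_def)
  qed
  \<comment> \<open>the form of \<open>Y - yy\<^sup>T\<close> at \<open>(e\<^sub>i, e\<^sub>i)\<close> is \<open>s - s\<^sup>2\<close>\<close>
  have le1: "x $ i + x' $ i \<le> 1" for i
  proof -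
    define s where "s = x $ i + x' $ i"
    have "0 \<le> z i \<bullet> ((Y - outer (diag_vec Y) (diag_vec Y)) *v z i)"
      using M by (simp add: psd_def)
    also have "\<dots> = s - s * s"
      using form[of i] yz[of i]
      by (simp add: matrix_vector_mult_diff_rdistrib outer_mult_vec inner_diff_right
          inner_commute s_def)
    finally have "s * s \<le> s" by simp
    then show ?thesis
      unfolding s_def[symmetric] by (smt (verit) mult_less_cancel_right1)
  qed
  \<comment> \<open>the slacks are nonnegative and the two trace constraints make them sum to \<open>n - m\<^sub>1 - m\<^sub>2\<close>\<close>
  have "(\<Sum>i\<in>UNIV. 1 - (x $ i + x' $ i)) = 0"
  proof -
    have "(\<Sum>i\<in>UNIV. x $ i) = real m1" "(\<Sum>i\<in>UNIV. x' $ i) = real m2"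
      using xe x'e by (simp_all add: inner_vec_def all_ones_vec_def)
    then show ?thesis
      using card by (simp add: sum_subtractf sum.distrib flip: of_nat_add)
  qed
  then have sum1: "x $ i + x' $ i = 1" for i
    using le1 by (simp add: sum_nonneg_eq_0_iff)
  then show diag22: "diag_vec (block22 Y) = all_ones_vec - x"
    by (simp add: vec_eq_iff all_ones_vec_def x'_def[symmetric] algebra_simps)
  have cols: "column i (block11 Y) + column i (block12 Y) = x"
    "column i (transpose (block12 Y)) + column i (block22 Y) = x'" for i
  proof -
    have "Y *v z i = (diag_vec Y \<bullet> z i) *\<^sub>R diag_vec Y"
      by (rule psd_diff_outer_kernel[OF M]) (simp add: form yz sum1)
    then show "column i (block11 Y) + column i (block12 Y) = x"
      "column i (transpose (block12 Y)) + column i (block22 Y) = x'"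
      unfolding Yz yz sum1 scaleR_one unfolding y stack_eq_iff by simp_all
  qed
  have b12: "block12 Y $ j $ i = x $ j - X $ j $ i" for i j
    using arg_cong[OF cols(1)[of i], of "\<lambda>v. v $ j"] by (simp add: column_def X_def)
  then show "block12 Y = outer x all_ones_vec - X"
    by (simp add: vec_eq_iff outer_def all_ones_vec_def)
  have "block22 Y $ j $ i = x' $ j - block12 Y $ i $ j" for i j
    using arg_cong[OF cols(2)[of i], of "\<lambda>v. v $ j"] by (simp add: column_def transpose_def)
  then show "block22 Y = all_ones_mat + X - outer x all_ones_vec - outer all_ones_vec x"
    using symmetric_mat_entry[OF symmetric_block11[OF sym]]
    by (simp add: vec_eq_iff outer_def all_ones_mat_def all_ones_vec_def b12 X_def
        diag22[folded x'_def])
qed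

lemma wz_feasible_imp_n_feasible:
  fixes Y :: "real^('n::finite + 'n)^('n + 'n)"
  assumes card: "m1 + m2 = CARD('n)" and Y: "Y \<in> wz_feasible m1 m2"
  shows "(block11 Y, diag_vec (block11 Y)) \<in> n_feasible m1"
    and "n_objective L (block11 Y, diag_vec (block11 Y)) = wz_objective L Y"
proof -
  note blocks = wz_feasible_blocks[OF card Y]
  have sym: "symmetric_mat Y" and M: "psd (Y - outer (diag_vec Y) (diag_vec Y))" and "0 \<le> Y"
    using Y by (auto simp: wz_feasible_def)
  have "0 \<le> block11 Y" "0 \<le> block12 Y" "0 \<le> block22 Y"
    using \<open>0 \<le> Y\<close> by (simp_all add: less_eq_vec_def block11_def block12_def block22_def)
  moreover have "diag_vec (block11 Y) \<bullet> all_ones_vec = real m1"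
    and "trace (all_ones_mat ** block11 Y) = (real m1)\<^sup>2"
    using Y by (simp_all add: wz_feasible_def flip: trace_eq_diag_vec)
  ultimately show "(block11 Y, diag_vec (block11 Y)) \<in> n_feasible m1"
    using blocks(1) psd_block11_of_diff_outer[OF sym M] symmetric_block11[OF sym]
    unfolding n_feasible_def blocks(3,4) by simp
  have "block11 Y + block22 Y = 2 *\<^sub>R block11 Y + all_ones_mat
      - outer (diag_vec (block11 Y)) all_ones_vec - outer all_ones_vec (diag_vec (block11 Y))"
    by (simp add: blocks(4) scaleR_2)
  then show "n_objective L (block11 Y, diag_vec (block11 Y)) = wz_objective L Y"
    by (simp add: n_objective_def wz_objective_def)
qed

section \<open>From (N) to (WZ)\<close>

definition block_mat :: "real^'n^'n \<Rightarrow> real^'n^'n \<Rightarrow> real^'n^'n \<Rightarrow> real^('n + 'n)^('n + 'n)" where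
  "block_mat A B D = (\<chi> k. case k of
     Inl i \<Rightarrow> stack (A $ i) (B $ i) | Inr i \<Rightarrow> stack (transpose B $ i) (D $ i))"

lemma block_mat_blocks [simp]:
  "block11 (block_mat A B D) = A" "block12 (block_mat A B D) = B" "block22 (block_mat A B D) = D"
  by (simp_all add: vec_eq_iff block_mat_def block11_def block12_def block22_def)

lemma symmetric_block_mat:
  "symmetric_mat A \<Longrightarrow> symmetric_mat D \<Longrightarrow> symmetric_mat (block_mat A B D)"
  by (simp add: symmetric_mat_def vec_sum_eq_iff block_mat_def transpose_def vec_eq_iff)

text \<open>
  The blocks are the ones that \<open>wz_feasible_blocks\<close> shows to be forced, so a
  feasible point of (WZ) that is mapped to \<open>(X, x)\<close> can only be this one.
\<close>

definition wz_lift :: "real^'n \<Rightarrow> real^'n^'n \<Rightarrow> real^('n + 'n)^('n + 'n)" where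
  "wz_lift x X = block_mat X (outer x all_ones_vec - X)
     (all_ones_mat + X - outer x all_ones_vec - outer all_ones_vec x)"

text \<open>
  With \<open>Z = X - xx\<^sup>T\<close>, the corrected lift has the blocks \<open>Z, -Z, -Z, Z\<close>, so the forms agree under
  \<open>(u, v) \<mapsto> u - v\<close>.
\<close>

lemma wz_lift_psd:
  fixes X :: "real^'n::finite^'n"
  assumes "symmetric_mat (wz_lift x X)" and "symmetric_mat X"
    and "diag_vec (wz_lift x X) = stack x (all_ones_vec - x)" and Z: "psd (X - outer x x)"
  shows "psd (wz_lift x X - outer (diag_vec (wz_lift x X)) (diag_vec (wz_lift x X)))"
    (is "psd ?M")
proof -
  have "symmetric_mat ?M"
    using symmetric_mat_entry[OF assms(1)]
    by (simp add: symmetric_mat_def transpose_def vec_eq_iff[of _ "wz_lift _ _ - _"] outer_def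
        mult.commute vec_eq_iff)
  moreover have "0 \<le> q \<bullet> (?M *v q)" for q
  proof -
    obtain u v where q: "q = stack u v"
      by (rule stack_cases)
    have tr: "transpose (outer x all_ones_vec - X) = outer all_ones_vec x - X"
      using symmetric_mat_entry[OF assms(2)]
      by (simp add: transpose_def vec_eq_iff outer_def)
    have "0 \<le> (u - v) \<bullet> ((X - outer x x) *v (u - v))"
      using Z by (simp add: psd_def)
    also have "\<dots> = q \<bullet> (?M *v q)"
      unfolding assms(3) q matrix_vector_mult_diff_rdistrib
        symmetric_mat_mult_stack[OF assms(1)] inner_diff_right
      unfolding wz_lift_def block_mat_blocks tr
      by (simp add: outer_mult_vec all_ones_mat_def matrix_vector_mult_diff_rdistrib
          matrix_vector_mult_add_rdistrib matrix_vector_mult_diff_distrib inner_stack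
          inner_diff_left inner_diff_right inner_add_left inner_add_right inner_commute
          algebra_simps)
    finally show ?thesis .
  qed
  ultimately show ?thesis
    by (simp add: psd_def)
qed

lemma n_feasible_imp_wz_feasible:
  fixes X :: "real^'n::finite^'n"
  assumes card: "m1 + m2 = CARD('n)" and "0 < m1" and Xx: "(X, x) \<in> n_feasible m1"
  shows "wz_lift x X \<in> wz_feasible m1 m2"
    and "wz_objective L (wz_lift x X) = n_objective L (X, x)"
proof -
  let ?e = "all_ones_vec :: real^'n"
  define B where "B = outer x ?e - X"
  define D where "D = all_ones_mat + X - outer x ?e - outer ?e x"
  have Y: "wz_lift x X = block_mat X B D"
    by (simp add: wz_lift_def B_def D_def)
  have sym: "symmetric_mat X" and xe: "x \<bullet> ?e = real m1"
    and J: "trace (all_ones_mat ** X) = (real m1)\<^sup>2" and Xe: "X *v ?e = real m1 *\<^sub>R x"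
    and nn: "0 \<le> X" "0 \<le> B" "0 \<le> D" and psd: "psd X" and dX: "diag_vec X = x"
    using Xx by (auto simp: n_feasible_def B_def D_def)
  have ex: "?e \<bullet> x = real m1"
    using xe by (simp add: inner_commute)
  have m2: "real m2 = real CARD('n) - real m1"
    by (simp flip: card)
  have dXi: "X $ i $ i = x $ i" for i
    using dX by (auto simp: vec_eq_iff diag_vec_def)
  have dB: "diag_vec B = 0"
    by (simp add: B_def vec_eq_iff diag_vec_def outer_def all_ones_vec_def dXi)
  have dD: "diag_vec D = ?e - x"
    by (simp add: D_def vec_eq_iff diag_vec_def outer_def all_ones_vec_def all_ones_mat_def dXi)
  have symD: "symmetric_mat D"
    using symmetric_mat_entry[OF sym]
    by (simp add: D_def symmetric_mat_def transpose_def vec_eq_iff outer_def all_ones_vec_def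
        all_ones_mat_def)
  have symY: "symmetric_mat (wz_lift x X)"
    unfolding Y by (rule symmetric_block_mat[OF sym symD])
  have dY: "diag_vec (wz_lift x X) = stack x (?e - x)"
    by (simp add: diag_vec_stack Y dX dD)
  have Z: "psd (X - outer x x)"
    using psd_diff_outer[OF psd Xe xe] \<open>0 < m1\<close> by simp
  have psdY: "psd (wz_lift x X - outer (diag_vec (wz_lift x X)) (diag_vec (wz_lift x X)))"
    by (rule wz_lift_psd[OF symY sym dY Z])
  have Be: "B *v ?e = real m2 *\<^sub>R x"
    by (simp add: B_def matrix_vector_mult_diff_rdistrib outer_mult_vec Xe
        all_ones_vec_inner_self m2 scaleR_diff_left)
  have De: "D *v ?e = real m2 *\<^sub>R (?e - x)"
    by (simp add: D_def matrix_vector_mult_diff_rdistrib matrix_vector_mult_add_rdistrib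
        all_ones_mat_def outer_mult_vec Xe xe all_ones_vec_inner_self m2 algebra_simps)
  have trD: "trace D = real m2"
    by (simp add: trace_eq_diag_vec dD inner_diff_left xe all_ones_vec_inner_self m2)
  have trX: "trace X = real m1"
    by (simp add: trace_eq_diag_vec dX xe)
  have JD: "trace (all_ones_mat ** D) = (real m2)\<^sup>2"
    by (simp add: trace_all_ones_mult De inner_diff_right ex all_ones_vec_inner_self
        m2 power2_eq_square)
  have "?e \<bullet> (transpose B *v ?e) = ?e \<bullet> (B *v ?e)"
    by (metis dot_lmul_matrix inner_commute transpose_matrix_vector)
  then have JB: "trace (all_ones_mat ** (B + transpose B)) = 2 * real m1 * real m2"
    by (simp add: trace_all_ones_mult matrix_vector_mult_add_rdistrib inner_add_right Be ex)
  have nnY: "0 \<le> wz_lift x X"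
  proof -
    have "0 \<le> wz_lift x X $ k $ l" for k l
      using nn by (cases k; cases l)
        (simp_all add: Y block_mat_def less_eq_vec_def transpose_def)
    then show ?thesis
      by (simp add: less_eq_vec_def)
  qed
  show "wz_lift x X \<in> wz_feasible m1 m2"
    using symY trX trD J JD dB JB psdY nnY by (simp add: wz_feasible_def Y)
  have "X + D = 2 *\<^sub>R X + all_ones_mat - outer x ?e - outer ?e x"
    by (simp add: D_def scaleR_2)
  then show "wz_objective L (wz_lift x X) = n_objective L (X, x)"
    by (simp add: n_objective_def wz_objective_def Y)
qed

section \<open>Equality of the optimal values\<close>

lemma optimal_value_eqI:
  assumes "\<And>a. a \<in> F \<Longrightarrow> \<exists>b\<in>G. g b = f a" and "\<And>b. b \<in> G \<Longrightarrow> \<exists>a\<in>F. f a = g b"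
  shows "optimal_value F f = optimal_value G g"
  unfolding optimal_value_def
  by (rule INF_eq) (metis assms order_refl)+

theorem theorem3:
  fixes m1 m2 :: nat
    and E :: "'n::finite set set"
    and w :: "'n set \<Rightarrow> real"
    and L :: "real^'n^'n"
  assumes "0 < m1" and "0 < m2"
    and "m1 + m2 = CARD('n)"
    and "m2 < m1"
    and "undirected_graph E"
    and "L = laplacian (adjacency_mat E w)"
  shows "wz_value m1 m2 L = n_value m1 L"
  unfolding wz_value_def n_value_def
proof (rule optimal_value_eqI)
  fix Y :: "real^('n + 'n)^('n + 'n)"
  assume "Y \<in> wz_feasible m1 m2"
  then show "\<exists>p\<in>n_feasible m1. n_objective L p = wz_objective L Y"
    using wz_feasible_imp_n_feasible[OF assms(3)] by blast
next
  fix p :: "(real^'n^'n) \<times> (real^'n)"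
  assume "p \<in> n_feasible m1"
  then show "\<exists>Y\<in>wz_feasible m1 m2. wz_objective L Y = n_objective L p"
    using n_feasible_imp_wz_feasible[OF assms(3,1)] by (cases p) blast
qed

end
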